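(* There exists no constant $g$ such that $$\operatorname{K}(\rho_{AB})\le \operatorname{K}(\rho_A)+\operatorname{K}(\rho_B\mid\boldsymbol\rho_A)+g\,\log\bigl(n\,\operatorname{K}(\rho_{AB})\bigr)$$ for every natural number $n$ and every $n$-qubit (dcq-computable) bipartite quantum state $\rho_{AB}$. Here $\rho_{AB}$ is a state of $n=n_A+n_B$ qubits ($n_A,n_B\ge1$), $\rho_A$ is the reduced state of the first $n_A$ qubits and $\rho_B$ the reduced state of the last $n_B$ qubits; in $\log(n\,\operatorname{K}(\rho_{AB}))$ the value $\operatorname{K}(\rho_{AB})$ is replaced by $1$ if it is $0$.
   Context: A quantum state is an $n$-qubit density operator for some $n$. $D(\rho,\sigma)=\tfrac12\|\rho-\sigma\|_1$ is the trace distance; $\log$ is base $2$. **dcq-TM.** A deterministic-control quantum Turing machine (dcq-TM) is a pair $(Q,\delta)$, where $Q$ is a finite set of control states containing two distinct states $q_s$ (starting) and $q_h$ (halting), and $\delta:Q\times A\to U\times \Delta\times A\times \Delta\times Q$ is the transition function, with $A=\{0,1,\Box\}$ the alphabet of a two-way infinite classical tape, $\Delta=\{L,N,R\}$ the head displacements, and $U=\{\mathbb 1,\mathsf H,\mathsf S,\pi/8,\mathsf{Sw},\textsf{c-Not}\}$ the gate set (identity, Hadamard, phase gate, $\pi/8$ gate, swap, controlled-not). The machine also has a two-way infinite quantum tape, each cell being a qubit. If $\delta(q,a)=(u,d,a',d',q')$, then in state $q$ with the classical head reading $a$, the machine applies gate $u$ at the position of the quantum head (two-qubit gates act on the cell under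 the head and its right neighbour), moves the quantum head by $d$, writes $a'$, moves the classical head by $d'$, and passes to state $q'$. Each tape has an anchor cell with index $0$. On input $(x;\rho)$, with $x\in\{0,1\}^*$ and $\rho$ an $n$-qubit state, the machine starts in $q_s$ with both heads on the anchors; the classical tape contains $x\,\Box\,n$ ($n$ in binary) starting at cell $1$ and is blank elsewhere; quantum cells $1,\dots,n$ are in state $\rho$, all others in $|0\rangle\langle 0|$. When $q_h$ is reached, the classical output $y$ is the string between the anchor and the first blank to its right, $m$ is the number written between the first and second blanks to the right of the anchor, and the quantum output is the reduced state of quantum cells $1,\dots,m$. One writes $\mathsf T(x;\rho)=(y;\sigma)$ and $\mathsf T^{(Q)}(x;\rho)=\sigma$. The symbol $\epsilon$ denotes a quantum input/output of size zero. Natural numbers are input as strings via a fixed one-to-one effective encoding. Tuples of strings are encoded as $(x_1,\dots,x_r)=1^{|x_1|}0x_1\cdots 1^{|x_{r-1}|}0x_{r-1}x_r$. **Universal dcq-TM.** A dcq-TM $\mathsf U$ is universal (with the s-m-n property) if for every dcq-TM $\mathsf V$ there are a computable map $s:\{0,1\}^*\to\{0,1\}^*$ and a constant $c$ with $|s(p)|\le|p|+c$ and $\mathsf U((s(p),y);\rho)=\mathsf V((p,y);\rho)$ for all strings $p,y$ and quantum inputs $\rho$ (one side halts iff the other does, with the same output). **Complexities.** Fix a universal dcq-TM $\mathsf U$. Then $$\operatorname{K}(\rho)=\inf\{|p|:\ \forall k\ge 1,\ D(\mathsf U^{(Q)}((p,k);\epsilon),\rho)\le 1/k\},$$ where the condition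 includes halting with a quantum output on the same number of qubits as $\rho$, and $\inf\emptyset=\infty$. The state $\rho$ is dcq-computable iff $\operatorname{K}(\rho)<\infty$, equivalently iff all entries of its density matrix in the computational basis are computable complex numbers. **Conditioning on a classical representation.** For a dcq-computable state $\sigma$, $\boldsymbol\sigma$ denotes its density matrix in the computational basis, given as a string: a string $e$ encodes $\boldsymbol\sigma$ if it codes (by a fixed effective coding of arrays, from which the dimension can be read off) an array of programs of classical Turing machines, one for the real and one for the imaginary part $r$ of each entry, each of which on every input $k\ge1$ outputs a rational within $1/k$ of $r$. $\operatorname{K}(\rho\mid\boldsymbol\sigma)$ is the infimum of $|p|$ over programs $p$ such that for every string $e$ encoding $\boldsymbol\sigma$ and all $k\ge1$, $D(\mathsf U^{(Q)}((p,e,k);\epsilon),\rho)\le 1/k$. *)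

theory Defs
  imports
    "Jordan_Normal_Form.Schur_Decomposition"
    "HOL-Analysis.Infinite_Sum"
    "HOL-Library.Extended_Nat"
    "HOL-Library.Extended_Real"
    "HOL-Library.Nat_Bijection"
begin

section \<open>Strings, numbers and tuples\<close>

type_synonym str = "bool list"

text \<open>Binary notation, most significant digit first, no leading zeros, and 0 is written as
  a single digit 0.  The reading function also accepts leading zeros and gives the empty string
  the value 0.\<close>

fun bin :: "nat \<Rightarrow> str" where
  "bin n = (if n < 2 then [n = 1] else bin (n div 2) @ [odd n])"

declare bin.simps [simp del]

definition bin_val :: "str \<Rightarrow> nat" where
  "bin_val w = foldl (\<lambda>v b. 2 * v + of_bool b) 0 w"

fun tuple :: "str list \<Rightarrow> str" where
  "tuple [] = []"
| "tuple [x] = x"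
| "tuple (x # y # zs) = replicate (length x) True @ [False] @ x @ tuple (y # zs)"

section \<open>Classical tapes and classical Turing machines\<close>

datatype sym = Sym0 | Sym1 | Blank

datatype move = MoveL | Stay | MoveR

type_synonym tape = "int \<Rightarrow> sym"

fun displacement :: "move \<Rightarrow> int" where
  "displacement MoveL = -1"
| "displacement Stay = 0"
| "displacement MoveR = 1"

definition sym_of :: "bool \<Rightarrow> sym" where
  "sym_of b = (if b then Sym1 else Sym0)"

text \<open>The tape with \<open>w\<close> written from cell 1 on, and blank elsewhere.\<close>

definition tape_of :: "sym list \<Rightarrow> tape" where
  "tape_of w = (\<lambda>c. if 1 \<le> c \<and> c \<le> int (length w) then w ! (nat c - 1) else Blank)"

text \<open>Number of cells from cell \<open>i\<close> (inclusive) up to the first blank, and the word on them.\<close>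

definition word_len :: "tape \<Rightarrow> int \<Rightarrow> nat" where
  "word_len t i = (LEAST k. t (i + int k) = Blank)"

definition word_at :: "tape \<Rightarrow> int \<Rightarrow> str" where
  "word_at t i = map (\<lambda>k. t (i + int k) = Sym1) [0..<word_len t i]"

definition run_until :: "('c \<Rightarrow> bool) \<Rightarrow> ('c \<Rightarrow> 'c) \<Rightarrow> 'c \<Rightarrow> 'c option" where
  "run_until halted step c =
     (if \<exists>t. halted ((step ^^ t) c)
      then Some ((step ^^ (LEAST t. halted ((step ^^ t) c))) c)
      else None)"

text \<open>A classical machine is its table: row \<open>q\<close> holds the instructions (symbol to write,
  move, next state) of state \<open>q\<close> on reading 0, 1 and blank.  State 0 is the starting state, and
  the machine halts on entering a state that has no row.\<close>

type_synonym instr = "sym \<times> move \<times> nat"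
type_synonym ctm = "(instr \<times> instr \<times> instr) list"

fun instr_for :: "instr \<times> instr \<times> instr \<Rightarrow> sym \<Rightarrow> instr" where
  "instr_for (a, b, c) Sym0 = a"
| "instr_for (a, b, c) Sym1 = b"
| "instr_for (a, b, c) Blank = c"

fun ctm_step :: "ctm \<Rightarrow> nat \<times> tape \<times> int \<Rightarrow> nat \<times> tape \<times> int" where
  "ctm_step M (q, t, h) =
     (let (a, d, q') = instr_for (M ! q) (t h) in (q', t(h := a), h + displacement d))"

definition ctm_run :: "ctm \<Rightarrow> str \<Rightarrow> str option" where
  "ctm_run M x =
     map_option (\<lambda>(q, t, h). word_at t 1)
       (run_until (\<lambda>(q, t, h). length M \<le> q) (ctm_step M) (0, tape_of (map sym_of x), 0))"

definition computable :: "(str \<Rightarrow> str) \<Rightarrow> bool" where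
  "computable f \<longleftrightarrow> (\<exists>M. \<forall>x. ctm_run M x = Some (f x))"

text \<open>The program (a string) of a classical machine.  Every instruction code is
  self-delimiting, so the table can be read off from the concatenation.\<close>

fun sym_code :: "sym \<Rightarrow> str" where
  "sym_code Sym0 = [False, False]"
| "sym_code Sym1 = [False, True]"
| "sym_code Blank = [True, False]"

fun move_code :: "move \<Rightarrow> str" where
  "move_code MoveL = [False, False]"
| "move_code Stay = [False, True]"
| "move_code MoveR = [True, False]"

fun instr_code :: "instr \<Rightarrow> str" where
  "instr_code (a, d, q) = sym_code a @ move_code d @ replicate q True @ [False]"

definition ctm_code :: "ctm \<Rightarrow> str" where
  "ctm_code M = concat (map (\<lambda>(a, b, c). instr_code a @ instr_code b @ instr_code c) M)"

text \<open>Encodings of natural numbers as strings: one-to-one and effective, i.e.\ obtained from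
  the binary notation by a computable map.\<close>

definition effective_encoding :: "(nat \<Rightarrow> str) \<Rightarrow> bool" where
  "effective_encoding num \<longleftrightarrow> inj num \<and> (\<exists>f. computable f \<and> (\<forall>n. f (bin n) = num n))"

section \<open>States of finitely many qubits\<close>

text \<open>An \<open>n\<close>-qubit state is its density matrix in the computational basis.  Qubit 1 is
  the most significant bit of a basis index (the Kronecker product convention).\<close>

definition mat_trace :: "complex mat \<Rightarrow> complex" where
  "mat_trace A = (\<Sum>i<dim_row A. A $$ (i, i))"

definition qstate :: "nat \<Rightarrow> complex mat \<Rightarrow> bool" where
  "qstate n \<rho> \<longleftrightarrow>
     \<rho> \<in> carrier_mat (2 ^ n) (2 ^ n) \<and>
     mat_adjoint \<rho> = \<rho> \<and>
     (\<forall>v \<in> carrier_vec (2 ^ n). 0 \<le> Re (scalar_prod (\<rho> *\<^sub>v v) (conjugate v))) \<and>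
     mat_trace \<rho> = 1"

text \<open>The trace norm is the sum of the singular values, that is, of the square roots of the
  eigenvalues (with multiplicity) of the product of the adjoint with the matrix.\<close>

definition trace_norm :: "complex mat \<Rightarrow> real" where
  "trace_norm A = (\<Sum>s\<in>#proots (char_poly (mat_adjoint A * A)). sqrt (Re s))"

definition trace_dist :: "complex mat \<Rightarrow> complex mat \<Rightarrow> real" where
  "trace_dist \<rho> \<sigma> = trace_norm (\<rho> - \<sigma>) / 2"

definition reduced_first :: "nat \<Rightarrow> nat \<Rightarrow> complex mat \<Rightarrow> complex mat" where
  "reduced_first nA nB \<rho> =
     mat (2 ^ nA) (2 ^ nA) (\<lambda>(i, j). \<Sum>k<2 ^ nB. \<rho> $$ (i * 2 ^ nB + k, j * 2 ^ nB + k))"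

definition reduced_last :: "nat \<Rightarrow> nat \<Rightarrow> complex mat \<Rightarrow> complex mat" where
  "reduced_last nA nB \<rho> =
     mat (2 ^ nB) (2 ^ nB) (\<lambda>(i, j). \<Sum>k<2 ^ nA. \<rho> $$ (k * 2 ^ nB + i, k * 2 ^ nB + j))"

definition empty_state :: "complex mat" where
  "empty_state = 1\<^sub>m 1"

section \<open>The quantum tape\<close>

text \<open>A computational basis state of the quantum tape assigns a bit to each cell; a state of the
  tape is a density kernel on basis states.  In all reachable configurations only
  finitely many entries of the kernel are nonzero.\<close>

type_synonym qbasis = "int \<Rightarrow> bool"
type_synonym qtape = "qbasis \<Rightarrow> qbasis \<Rightarrow> complex"

datatype gate = Ident | Hadamard | Phase | Pi8 | Swap | CNot

fun on_first :: "(bool \<Rightarrow> bool \<Rightarrow> complex) \<Rightarrow> bool \<times> bool \<Rightarrow> bool \<times> bool \<Rightarrow> complex" where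
  "on_first m (a, b) (a', b') = (if b = b' then m a a' else 0)"

text \<open>Matrix entries \<open>\<langle>out|u|in\<rangle>\<close> of the gates on the cell under the head
  (first component) and its right neighbour; the one-qubit gates act trivially on the latter.
  The cell under the head is the control of the controlled-not.\<close>

fun gate_entry :: "gate \<Rightarrow> bool \<times> bool \<Rightarrow> bool \<times> bool \<Rightarrow> complex" where
  "gate_entry Ident = on_first (\<lambda>a a'. of_bool (a = a'))"
| "gate_entry Hadamard = on_first (\<lambda>a a'. (if a \<and> a' then -1 else 1) / complex_of_real (sqrt 2))"
| "gate_entry Phase = on_first (\<lambda>a a'. if a \<noteq> a' then 0 else if a then \<i> else 1)"
| "gate_entry Pi8 = on_first (\<lambda>a a'. if a \<noteq> a' then 0 else if a then cis (pi / 4) else 1)"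
| "gate_entry Swap = (\<lambda>(a, b) (a', b'). of_bool (a = b' \<and> b = a'))"
| "gate_entry CNot = (\<lambda>(a, b) (a', b'). of_bool (a = a' \<and> b = (b' \<noteq> a')))"

text \<open>Conjugation of the density kernel by the gate \<open>u\<close> acting at the cells \<open>h\<close> and \<open>h + 1\<close>.\<close>

definition apply_gate :: "gate \<Rightarrow> int \<Rightarrow> qtape \<Rightarrow> qtape" where
  "apply_gate u h D = (\<lambda>x y. \<Sum>(a, b)\<in>UNIV. \<Sum>(c, d)\<in>UNIV.
     gate_entry u (x h, x (h + 1)) (a, b)
     * D (x(h := a, h + 1 := b)) (y(h := c, h + 1 := d))
     * cnj (gate_entry u (y h, y (h + 1)) (c, d)))"

text \<open>Index of the basis state of cells \<open>1, ..., n\<close>, and conversely the basis state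
  that is given by index \<open>i\<close> on these cells and by \<open>z\<close> on the others.\<close>

definition cells_index :: "nat \<Rightarrow> qbasis \<Rightarrow> nat" where
  "cells_index n x = (\<Sum>j=1..n. of_bool (x (int j)) * 2 ^ (n - j))"

definition set_cells :: "nat \<Rightarrow> nat \<Rightarrow> qbasis \<Rightarrow> qbasis" where
  "set_cells n i z = (\<lambda>c. if 1 \<le> c \<and> c \<le> int n then bit i (n - nat c) else z c)"

definition qtape_of :: "nat \<Rightarrow> complex mat \<Rightarrow> qtape" where
  "qtape_of n \<rho> = (\<lambda>x y.
     if \<forall>c. c \<notin> {1..int n} \<longrightarrow> \<not> x c \<and> \<not> y c
     then \<rho> $$ (cells_index n x, cells_index n y) else 0)"

text \<open>Reduced state of cells \<open>1, ..., m\<close>: the partial trace sums over the finitely supported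
  basis states \<open>z\<close> of the remaining cells.\<close>

definition read_qtape :: "nat \<Rightarrow> qtape \<Rightarrow> complex mat" where
  "read_qtape m D = mat (2 ^ m) (2 ^ m) (\<lambda>(i, j).
     \<Sum>\<^sub>\<infinity>z\<in>{z. finite {c. z c} \<and> (\<forall>c\<in>{1..int m}. \<not> z c)}.
       D (set_cells m i z) (set_cells m j z))"

section \<open>Deterministic-control quantum Turing machines\<close>

text \<open>Control states are taken from the natural numbers.\<close>

record dcqtm =
  states :: "nat set"
  q_start :: nat
  q_halt :: nat
  delta :: "nat \<Rightarrow> sym \<Rightarrow> gate \<times> move \<times> sym \<times> move \<times> nat"

definition dcq_TM :: "dcqtm \<Rightarrow> bool" where
  "dcq_TM T \<longleftrightarrow>
     finite (states T) \<and> q_start T \<in> states T \<and> q_halt T \<in> states T \<and> q_start T \<noteq> q_halt T \<and>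
     (\<forall>q\<in>states T. \<forall>a. case delta T q a of (u, d, a', d', q') \<Rightarrow> q' \<in> states T)"

record config =
  cstate :: nat
  ctape :: tape
  chead :: int
  qtape :: qtape
  qhead :: int

definition dcq_step :: "dcqtm \<Rightarrow> config \<Rightarrow> config" where
  "dcq_step T c =
     (case delta T (cstate c) (ctape c (chead c)) of (u, d, a', d', q') \<Rightarrow>
        \<lparr>cstate = q',
         ctape = (ctape c)(chead c := a'),
         chead = chead c + displacement d',
         qtape = apply_gate u (qhead c) (qtape c),
         qhead = qhead c + displacement d\<rparr>)"

definition dcq_init :: "dcqtm \<Rightarrow> str \<Rightarrow> nat \<Rightarrow> complex mat \<Rightarrow> config" where
  "dcq_init T x n \<rho> =
     \<lparr>cstate = q_start T,
      ctape = tape_of (map sym_of x @ [Blank] @ map sym_of (bin n)),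
      chead = 0,
      qtape = qtape_of n \<rho>,
      qhead = 0\<rparr>"

definition dcq_output :: "config \<Rightarrow> str \<times> complex mat" where
  "dcq_output c =
     (let y = word_at (ctape c) 1;
          m = bin_val (word_at (ctape c) (2 + int (length y)))
      in (y, read_qtape m (qtape c)))"

text \<open>The result of \<open>T\<close> on input \<open>(x; \<rho>)\<close> with \<open>\<rho>\<close> an \<open>n\<close>-qubit state; \<open>None\<close> if \<open>T\<close> does not
  halt.  The number of output qubits is determined by the dimension of the output matrix.\<close>

definition dcq_run :: "dcqtm \<Rightarrow> str \<Rightarrow> nat \<Rightarrow> complex mat \<Rightarrow> (str \<times> complex mat) option" where
  "dcq_run T x n \<rho> =
     map_option dcq_output
       (run_until (\<lambda>c. cstate c = q_halt T) (dcq_step T) (dcq_init T x n \<rho>))"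

definition universal_dcq_TM :: "dcqtm \<Rightarrow> bool" where
  "universal_dcq_TM U \<longleftrightarrow>
     dcq_TM U \<and>
     (\<forall>V. dcq_TM V \<longrightarrow>
       (\<exists>s c. computable s \<and>
         (\<forall>p. length (s p) \<le> length p + c) \<and>
         (\<forall>p y n \<rho>. qstate n \<rho> \<longrightarrow>
            dcq_run U (tuple [s p, y]) n \<rho> = dcq_run V (tuple [p, y]) n \<rho>)))"

section \<open>Complexities\<close>

text \<open>\<open>U\<close> halts on \<open>(x; \<epsilon>)\<close> with a quantum output that has as many qubits as \<open>\<rho>\<close> and is within
  trace distance \<open>\<delta>\<close> of it.\<close>

definition outputs_within :: "dcqtm \<Rightarrow> str \<Rightarrow> complex mat \<Rightarrow> real \<Rightarrow> bool" where
  "outputs_within U x \<rho> \<delta> \<longleftrightarrow>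
     (\<exists>y \<sigma>. dcq_run U x 0 empty_state = Some (y, \<sigma>) \<and>
            dim_row \<sigma> = dim_row \<rho> \<and> trace_dist \<sigma> \<rho> \<le> \<delta>)"

definition K :: "dcqtm \<Rightarrow> (nat \<Rightarrow> str) \<Rightarrow> complex mat \<Rightarrow> enat" where
  "K U num \<rho> =
     (INF p \<in> {p. \<forall>k\<ge>1. outputs_within U (tuple [p, num k]) \<rho> (1 / real k)}. enat (length p))"

definition dcq_computable :: "dcqtm \<Rightarrow> (nat \<Rightarrow> str) \<Rightarrow> complex mat \<Rightarrow> bool" where
  "dcq_computable U num \<rho> \<longleftrightarrow> K U num \<rho> < \<infinity>"

text \<open>\<open>p\<close> is the program of a classical machine that on every input \<open>k \<ge> 1\<close> outputs (the code
  of) a rational \<open>a / b\<close> within \<open>1 / k\<close> of \<open>r\<close>.\<close>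

definition real_program :: "(nat \<Rightarrow> str) \<Rightarrow> str \<Rightarrow> real \<Rightarrow> bool" where
  "real_program num p r \<longleftrightarrow>
     (\<exists>M. p = ctm_code M \<and>
        (\<forall>k\<ge>1. \<exists>(a::int) (b::nat). b \<ge> 1 \<and>
           ctm_run M (num k) = Some (tuple [num (int_encode a), num b]) \<and>
           \<bar>of_int a / of_nat b - r\<bar> \<le> 1 / real k))"

text \<open>An array is coded by the tuple of its dimension and the programs of its entries in
  row-major order, the real part of each entry preceding its imaginary part.\<close>

definition encodes :: "(nat \<Rightarrow> str) \<Rightarrow> str \<Rightarrow> complex mat \<Rightarrow> bool" where
  "encodes num e \<sigma> \<longleftrightarrow>
     (\<exists>ps. let N = dim_row \<sigma> in
        length ps = 2 * N * N \<and> e = tuple (num N # ps) \<and>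
        (\<forall>i<N. \<forall>j<N.
           real_program num (ps ! (2 * (N * i + j))) (Re (\<sigma> $$ (i, j))) \<and>
           real_program num (ps ! (2 * (N * i + j) + 1)) (Im (\<sigma> $$ (i, j)))))"

definition K_cond :: "dcqtm \<Rightarrow> (nat \<Rightarrow> str) \<Rightarrow> complex mat \<Rightarrow> complex mat \<Rightarrow> enat" where
  "K_cond U num \<rho> \<sigma> =
     (INF p \<in> {p. \<forall>e. encodes num e \<sigma> \<longrightarrow>
                    (\<forall>k\<ge>1. outputs_within U (tuple [p, e, num k]) \<rho> (1 / real k))}.
        enat (length p))"

end

theory Submission
  imports Defs
begin

text \<open>Correlations are invisible to the two terms on the right.  Let \<open>W\<close> be the gate \<open>\<pi>/8\<close> followed by the
  Hadamard gate, and apply \<open>W\<close> raised to the power \<open>t\<close> to one half of a Bell pair.  Both marginals are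
  the maximally mixed qubit for every \<open>t\<close>, so the right-hand side is a constant plus a
  logarithm of the left-hand side, which bounds the complexity of these two-qubit states
  independently of \<open>t\<close>.  A program determines the state that it approximates, so only
  finitely many states have bounded complexity, and it remains to see that infinitely many of these
  states are distinct and have finite complexity.

  Finite complexity is clear: each state is prepared exactly by its own loop-free machine, which ignores
  its input, and universality turns this machine with the empty program into a program for \<open>U\<close>.

  For distinctness, follow the Bloch vector \<open>(x, y, z)\<close> of \<open>W\<close> raised to the power \<open>t\<close>, applied to the
  first basis state.  It evolves
  by \<open>(x, y, z) \<mapsto> (z, - (x + y) / \<surd>2, (x - y) / \<surd>2)\<close>.  Clearing the denominator, a vector over
  \<open>\<int>[\<surd>2]\<close> that is congruent to \<open>(0, 1, 1)\<close> modulo \<open>\<surd>2\<close> remains so, hence the exponent of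
  \<open>\<surd>2\<close> in the denominator of \<open>z\<close> grows with \<open>t\<close>.\<close>

section \<open>Trace norm\<close>

lemma sum_mset_image_nonneg:
  fixes f :: "'a \<Rightarrow> real"
  assumes "\<And>s. s \<in># M \<Longrightarrow> 0 \<le> f s"
  shows "0 \<le> (\<Sum>s\<in>#M. f s)"
  using assms by (induction M) auto

lemma Re_sum_mset: "Re (\<Sum>\<^sub># M) = (\<Sum>s\<in>#M. Re s)"
  by (induction M) auto

text \<open>Only nonnegative cross terms are dropped. With \<open>f\<close> the square root of an
  eigenvalue, this compares the Frobenius norm with the trace norm.\<close>

lemma sum_mset_nonneg_power2_le:
  fixes f :: "'a \<Rightarrow> real"
  assumes "\<And>s. s \<in># M \<Longrightarrow> 0 \<le> f s"
  shows "(\<Sum>s\<in>#M. (f s)\<^sup>2) \<le> (\<Sum>s\<in>#M. f s)\<^sup>2"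
  using assms
proof (induction M)
  case (add x M)
  define S where "S = (\<Sum>s\<in>#M. f s)"
  have "0 \<le> S"
    unfolding S_def using add.prems by (intro sum_mset_image_nonneg) simp
  moreover have "0 \<le> f x"
    using add.prems by simp
  ultimately have "(f x)\<^sup>2 + S\<^sup>2 \<le> (f x + S)\<^sup>2"
    by (simp add: power2_sum)
  moreover have "(\<Sum>s\<in>#M. (f s)\<^sup>2) \<le> S\<^sup>2"
    using add by (simp add: S_def)
  ultimately have "(f x)\<^sup>2 + (\<Sum>s\<in>#M. (f s)\<^sup>2) \<le> (f x + S)\<^sup>2"
    by linarith
  then show ?case
    by (simp add: S_def)
qed simp

section \<open>Trace, adjoint and eigenvalues\<close>

lemma mat_trace_mult_commute:
  assumes "A \<in> carrier_mat m n" "B \<in> carrier_mat n m"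
  shows "mat_trace (A * B) = mat_trace (B * A)"
proof -
  have "mat_trace (A * B) = (\<Sum>i<m. \<Sum>k<n. A $$ (i, k) * B $$ (k, i))"
    using assms by (auto simp: mat_trace_def scalar_prod_def atLeast0LessThan intro!: sum.cong)
  also have "\<dots> = (\<Sum>k<n. \<Sum>i<m. B $$ (k, i) * A $$ (i, k))"
    by (subst sum.swap) (simp add: mult.commute)
  also have "\<dots> = mat_trace (B * A)"
    using assms by (auto simp: mat_trace_def scalar_prod_def atLeast0LessThan intro!: sum.cong)
  finally show ?thesis .
qed

text \<open>Schur triangularisation: the trace is invariant under similarity, and the diagonal of
  the triangular form lists the eigenvalues with multiplicity.\<close>

lemma mat_trace_eq_sum_proots:
  assumes "A \<in> carrier_mat n n"
  shows "mat_trace A = \<Sum>\<^sub># (proots (char_poly A))"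
proof -
  obtain es where es: "char_poly A = (\<Prod>a\<leftarrow>es. [:- a, 1:])"
    using char_poly_factorized[OF assms] by blast
  obtain B P Q where "schur_decomposition A es = (B, P, Q)"
    by (cases "schur_decomposition A es")
  from schur_decomposition[OF assms es this]
  have wit: "similar_mat_wit A B P Q" and diag: "diag_mat B = es"
    by auto
  note D = similar_mat_witD2[OF assms wit]
  have "mat_trace A = mat_trace (P * (B * Q))"
    using D by (simp add: assoc_mult_mat[of P n n B n Q n])
  also have "\<dots> = mat_trace ((B * Q) * P)"
    using D by (intro mat_trace_mult_commute) auto
  also have "(B * Q) * P = B"
    using D by (simp add: assoc_mult_mat[of B n n Q n P n])
  also have "mat_trace B = sum_list (diag_mat B)"
    by (simp add: mat_trace_def diag_mat_def interv_sum_list_conv_sum_set_nat atLeast0LessThan)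
  also have "\<dots> = \<Sum>\<^sub># (mset es)"
    by (simp add: diag sum_mset_sum_list)
  also have "mset es = proots (char_poly A)"
    unfolding es
    by (induction es) (simp_all add: proots_mult prod_list_zero_iff image_iff del: mult_pCons_left)
  finally show ?thesis .
qed

lemma mat_adjoint_carrier:
  "A \<in> carrier_mat m n \<Longrightarrow> mat_adjoint A \<in> carrier_mat n m"
  by (auto simp: mat_adjoint_def)

lemma mat_adjoint_index:
  assumes "i < dim_col A" "j < dim_row A"
  shows "mat_adjoint A $$ (i, j) = conjugate (A $$ (j, i))"
  using assms by (simp add: mat_adjoint_def mat_of_rows_def)

lemma mat_adjoint_mult_mult_vec:
  fixes A :: "complex mat"
  assumes A: "A \<in> carrier_mat m n" and v: "v \<in> carrier_vec n"
  shows "((mat_adjoint A * A) *\<^sub>v v) \<bullet>c v = (A *\<^sub>v v) \<bullet>c (A *\<^sub>v v)"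
proof -
  have adj: "mat_adjoint A \<in> carrier_mat n m"
    by (rule mat_adjoint_carrier[OF A])
  have adjv: "(mat_adjoint A *\<^sub>v w) $ i = (\<Sum>k<m. cnj (A $$ (k, i)) * w $ k)"
    if "w \<in> carrier_vec m" "i < n" for w i
    using A that carrier_matD[OF adj]
    by (simp add: scalar_prod_def mat_adjoint_index atLeast0LessThan)
  have "((mat_adjoint A * A) *\<^sub>v v) \<bullet>c v = (mat_adjoint A *\<^sub>v (A *\<^sub>v v)) \<bullet>c v"
    using assoc_mult_mat_vec[OF adj A v] by simp
  also have "\<dots> = (\<Sum>i<n. \<Sum>k<m. cnj (A $$ (k, i)) * (A *\<^sub>v v) $ k * cnj (v $ i))"
    using A v adjv[OF mult_mat_vec_carrier[OF A v]]
    by (simp add: scalar_prod_def[of _ "conjugate v"] sum_distrib_right atLeast0LessThan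
        del: index_mult_mat_vec)
  also have "\<dots> = (\<Sum>k<m. \<Sum>i<n. cnj (A $$ (k, i)) * (A *\<^sub>v v) $ k * cnj (v $ i))"
    by (rule sum.swap)
  also have "\<dots> = (\<Sum>k<m. (A *\<^sub>v v) $ k * cnj (\<Sum>i<n. A $$ (k, i) * v $ i))"
    by (simp add: sum_distrib_left mult_ac)
  also have "\<dots> = (A *\<^sub>v v) \<bullet>c (A *\<^sub>v v)"
    using A v by (auto simp: scalar_prod_def atLeast0LessThan intro!: sum.cong)
  finally show ?thesis .
qed

text \<open>For an eigenvector \<open>v\<close>, the eigenvalue times the squared norm of
  \<open>v\<close> is the squared norm of \<open>A *\<^sub>v v\<close>. The sign matters because
  \<open>sqrt\<close> is negative at negative reals.\<close>

lemma proots_adjoint_mult_nonneg: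
  fixes A :: "complex mat"
  assumes A: "A \<in> carrier_mat n n" and "s \<in># proots (char_poly (mat_adjoint A * A))"
  shows "0 \<le> Re s"
proof -
  have B: "mat_adjoint A * A \<in> carrier_mat n n"
    using A mat_adjoint_carrier[OF A] by simp
  have "char_poly (mat_adjoint A * A) \<noteq> 0"
    using degree_monic_char_poly[OF B] by auto
  then have "poly (char_poly (mat_adjoint A * A)) s = 0"
    using assms(2) by simp
  then obtain v where "eigenvector (mat_adjoint A * A) v s"
    using eigenvalue_root_char_poly[OF B] unfolding eigenvalue_def by blast
  then have v: "v \<in> carrier_vec n" "v \<noteq> 0\<^sub>v n" and
    ev: "(mat_adjoint A * A) *\<^sub>v v = s \<cdot>\<^sub>v v"
    using B by (auto simp: eigenvector_def)
  have "s * (v \<bullet>c v) = (A *\<^sub>v v) \<bullet>c (A *\<^sub>v v)"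
    using mat_adjoint_mult_mult_vec[OF A v(1)] v(1) by (simp add: ev)
  moreover have "0 \<le> (A *\<^sub>v v) \<bullet>c (A *\<^sub>v v)"
    by (rule conjugate_square_ge_0_vec)
  moreover have pos: "0 < v \<bullet>c v"
    using v by (simp add: conjugate_square_greater_0_vec)
  ultimately have "0 \<le> Re s * Re (v \<bullet>c v)"
    by (metis diff_zero less_complex_def less_eq_complex_def mult_zero_right times_complex.sel(1)
        zero_complex.sel)
  moreover have "0 < Re (v \<bullet>c v)"
    using pos by (simp add: less_complex_def)
  ultimately show ?thesis
    by (simp add: zero_le_mult_iff)
qed

text \<open>An entry is bounded by the Frobenius norm, whose square is the sum of the squared
  singular values and so at most the square of their sum. This turns closeness in trace distance
  into entrywise closeness.\<close>

lemma norm_index_le_trace_norm: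
  assumes A: "A \<in> carrier_mat n n" and ij: "i < n" "j < n"
  shows "norm (A $$ (i, j)) \<le> trace_norm A"
proof -
  let ?R = "proots (char_poly (mat_adjoint A * A))"
  have B: "mat_adjoint A * A \<in> carrier_mat n n"
    using A mat_adjoint_carrier[OF A] by simp
  have nonneg: "0 \<le> Re s" if "s \<in># ?R" for s
    using proots_adjoint_mult_nonneg[OF A that] .
  have frob: "complex_of_real (\<Sum>l<n. \<Sum>k<n. (norm (A $$ (k, l)))\<^sup>2) = mat_trace (mat_adjoint A * A)"
    using A carrier_matD[OF mat_adjoint_carrier[OF A]]
    by (auto simp: mat_trace_def scalar_prod_def mat_adjoint_index complex_norm_square
        atLeast0LessThan mult.commute simp del: of_real_power intro!: sum.cong)
  have "(norm (A $$ (i, j)))\<^sup>2 \<le> (\<Sum>k<n. (norm (A $$ (k, j)))\<^sup>2)"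
    using ij by (intro member_le_sum[of i "{..<n}" "\<lambda>k. (norm (A $$ (k, j)))\<^sup>2"]) auto
  also have "\<dots> \<le> (\<Sum>l<n. \<Sum>k<n. (norm (A $$ (k, l)))\<^sup>2)"
    using ij by (intro member_le_sum[of j "{..<n}" "\<lambda>l. \<Sum>k<n. (norm (A $$ (k, l)))\<^sup>2"])
      (auto intro: sum_nonneg)
  also have "(\<Sum>l<n. \<Sum>k<n. (norm (A $$ (k, l)))\<^sup>2) = Re (\<Sum>\<^sub># ?R)"
    by (metis Re_complex_of_real frob mat_trace_eq_sum_proots[OF B])
  also have "\<dots> = (\<Sum>s\<in>#?R. Re s)"
    by (rule Re_sum_mset)
  also have "\<dots> = (\<Sum>s\<in>#?R. (sqrt (Re s))\<^sup>2)"
    using nonneg by (intro arg_cong[of _ _ sum_mset] image_mset_cong) simp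
  also have "\<dots> \<le> (trace_norm A)\<^sup>2"
    unfolding trace_norm_def using nonneg by (intro sum_mset_nonneg_power2_le) simp
  finally show ?thesis
    using nonneg by (intro power2_le_imp_le[of "norm (A $$ (i, j))"]) (auto simp: trace_norm_def intro!: sum_mset_image_nonneg)
qed

lemma trace_norm_zero: "trace_norm (0\<^sub>m n n) = 0"
proof -
  have "mat_adjoint (0\<^sub>m n n :: complex mat) * 0\<^sub>m n n = 0\<^sub>m n n"
    by (intro right_mult_zero_mat mat_adjoint_carrier zero_carrier_mat)
  moreover have "map (\<lambda>a. [:- a, 1:]) (diag_mat (0\<^sub>m n n :: complex mat)) = replicate n [:0, 1:]"
    by (intro nth_equalityI) (auto simp: diag_mat_def)
  then have "char_poly (0\<^sub>m n n :: complex mat) = [:0, 1:] ^ n"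
    by (subst char_poly_upper_triangular[of _ n]) (auto simp: prod_list_replicate)
  ultimately show ?thesis
    by (simp add: trace_norm_def proots_power)
qed

lemma trace_dist_self:
  assumes "\<rho> \<in> carrier_mat n n"
  shows "trace_dist \<rho> \<rho> = 0"
  using assms by (simp add: trace_dist_def trace_norm_zero)

lemma norm_index_diff_le_trace_dist:
  assumes "\<rho> \<in> carrier_mat n n" "\<sigma> \<in> carrier_mat n n" "i < n" "j < n"
  shows "norm (\<rho> $$ (i, j) - \<sigma> $$ (i, j)) \<le> 2 * trace_dist \<rho> \<sigma>"
  using norm_index_le_trace_norm[OF minus_carrier_mat[OF assms(2)], of i j \<rho>] assms
  by (simp add: trace_dist_def)

section \<open>Straight-line machines\<close>

type_synonym sl_instr = "gate \<times> move \<times> sym \<times> move"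

text \<open>The control state is a program counter that advances whatever symbol is read. Past the
  last instruction the machine idles, which keeps \<open>delta\<close> inside the finite set of
  states.\<close>

definition straight_line :: "sl_instr list \<Rightarrow> dcqtm" where
  "straight_line P =
     \<lparr>states = {0..length P}, q_start = 0, q_halt = length P,
      delta = (\<lambda>q a. if q < length P then (case P ! q of (u, d, a', d') \<Rightarrow> (u, d, a', d', Suc q))
                      else (Ident, Stay, a, Stay, q))\<rparr>"

fun exec_instr :: "sl_instr \<Rightarrow> config \<Rightarrow> config" where
  "exec_instr (u, d, a, d') c =
     \<lparr>cstate = Suc (cstate c), ctape = (ctape c)(chead c := a), chead = chead c + displacement d',
      qtape = apply_gate u (qhead c) (qtape c), qhead = qhead c + displacement d\<rparr>"

lemma dcq_TM_straight_line:
  assumes "P \<noteq> []"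
  shows "dcq_TM (straight_line P)"
  using assms by (auto simp: dcq_TM_def straight_line_def split: prod.split)

lemma cstate_fold_exec_instr: "cstate (fold exec_instr P c) = cstate c + length P"
proof (induction P arbitrary: c)
  case (Cons i P)
  then show ?case
    by (cases i) simp
qed simp

lemma dcq_step_straight_line:
  assumes "cstate c < length P"
  shows "dcq_step (straight_line P) c = exec_instr (P ! cstate c) c"
  using assms by (cases "P ! cstate c") (simp add: dcq_step_def straight_line_def)

lemma dcq_steps_straight_line:
  assumes "cstate c = 0" "t \<le> length P"
  shows "(dcq_step (straight_line P) ^^ t) c = fold exec_instr (take t P) c"
  using assms(2)
proof (induction t)
  case (Suc t)
  have "cstate (fold exec_instr (take t P) c) = t"
    using Suc assms(1) by (simp add: cstate_fold_exec_instr)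
  then show ?case
    using Suc by (simp add: dcq_step_straight_line take_Suc_conv_app_nth)
qed simp

lemma dcq_run_straight_line:
  "dcq_run (straight_line P) x n \<rho> =
     Some (dcq_output (fold exec_instr P (dcq_init (straight_line P) x n \<rho>)))"
proof -
  let ?c = "dcq_init (straight_line P) x n \<rho>"
  let ?halted = "\<lambda>t. cstate ((dcq_step (straight_line P) ^^ t) ?c) = q_halt (straight_line P)"
  have init: "cstate ?c = 0"
    by (simp add: dcq_init_def straight_line_def)
  have halt: "q_halt (straight_line P) = length P"
    by (simp add: straight_line_def)
  have halted_iff: "?halted t \<longleftrightarrow> t = length P" if "t \<le> length P" for t
    using that by (simp add: dcq_steps_straight_line[OF init] cstate_fold_exec_instr init halt)
  \<comment> \<open>The counter after \<open>t\<close> steps is \<open>t\<close>, so the halting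
    state is met at time \<open>length P\<close> and not before.\<close>
  have "(LEAST t. ?halted t) = length P"
    by (rule Least_equality) (use halted_iff in \<open>auto intro: leI\<close>)
  moreover have "\<exists>t. ?halted t"
    using halted_iff by blast
  ultimately show ?thesis
    using dcq_steps_straight_line[OF init, of "length P" P]
    by (simp add: dcq_run_def run_until_def)
qed

section \<open>Words on the classical tape\<close>

lemma word_at_blank: "t i = Blank \<Longrightarrow> word_at t i = []"
  by (simp add: word_at_def word_len_def Least_equality)

text \<open>\<open>word_len\<close> is a least number, so peeling off one symbol requires that a
  blank occurs at all.\<close>

lemma word_at_nonblank:
  assumes "t i \<noteq> Blank" "\<exists>k. t (i + int k) = Blank"
  shows "word_at t i = (t i = Sym1) # word_at t (i + 1)"
proof -
  have "word_len t i = Suc (LEAST k. t (i + int (Suc k)) = Blank)"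
    unfolding word_len_def using assms Least_Suc[of "\<lambda>k. t (i + int k) = Blank"] by auto
  then have "word_len t i = Suc (word_len t (i + 1))"
    by (simp add: word_len_def add_ac)
  then show ?thesis
    by (simp add: word_at_def upt_conv_Cons[of 0] map_Suc_upt[symmetric] add_ac del: upt_Suc)
qed

section \<open>Pure states of cells 1 and 2\<close>

definition pair_tape :: "(bool \<Rightarrow> bool \<Rightarrow> complex) \<Rightarrow> qtape" where
  "pair_tape f = (\<lambda>x y. if \<forall>c. c \<noteq> 1 \<and> c \<noteq> 2 \<longrightarrow> \<not> x c \<and> \<not> y c
     then f (x 1) (x 2) * cnj (f (y 1) (y 2)) else 0)"

definition gate_on_pair :: "gate \<Rightarrow> (bool \<Rightarrow> bool \<Rightarrow> complex) \<Rightarrow> bool \<Rightarrow> bool \<Rightarrow> complex" where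
  "gate_on_pair u f = (\<lambda>a b. \<Sum>(a', b')\<in>UNIV. gate_entry u (a, b) (a', b') * f a' b')"

lemma qtape_of_empty_state: "qtape_of 0 empty_state = pair_tape (\<lambda>a b. of_bool (\<not> a \<and> \<not> b))"
proof (intro ext)
  fix x y :: qbasis
  have "(\<forall>c. \<not> x c \<and> \<not> y c) \<longleftrightarrow>
    (\<forall>c. c \<noteq> 1 \<and> c \<noteq> 2 \<longrightarrow> \<not> x c \<and> \<not> y c) \<and> \<not> x 1 \<and> \<not> x 2 \<and> \<not> y 1 \<and> \<not> y 2"
    by metis
  then show "qtape_of 0 empty_state x y = pair_tape (\<lambda>a b. of_bool (\<not> a \<and> \<not> b)) x y"
    by (simp add: qtape_of_def pair_tape_def empty_state_def cells_index_def) blast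
qed

lemma sum_UNIV_bool_pair:
  "(\<Sum>(a, b)\<in>UNIV. g a b) = g False False + g False True + g True False + g True True"
  for g :: "bool \<Rightarrow> bool \<Rightarrow> 'a :: comm_monoid_add"
proof -
  have "(UNIV :: (bool \<times> bool) set) = UNIV \<times> UNIV"
    by simp
  then have "(\<Sum>(a, b)\<in>UNIV. g a b) = (\<Sum>a\<in>UNIV. \<Sum>b\<in>UNIV. g a b)"
    by (simp only: sum.cartesian_product)
  then show ?thesis
    by (simp add: UNIV_bool add_ac)
qed

lemma apply_gate_Ident: "apply_gate Ident h D = D"
  by (intro ext) (auto simp: apply_gate_def sum_UNIV_bool_pair fun_upd_idem)

text \<open>A gate at cell 1 touches only cells 1 and 2, so the rank-one form persists and four
  amplitudes can be tracked instead of the kernel.\<close>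

lemma apply_gate_pair_tape: "apply_gate u 1 (pair_tape f) = pair_tape (gate_on_pair u f)"
proof (intro ext)
  fix x y :: qbasis
  define P where "P \<longleftrightarrow> (\<forall>c. c \<noteq> 1 \<and> c \<noteq> 2 \<longrightarrow> \<not> x c \<and> \<not> y c)"
  have upd: "pair_tape f (x(1 := a, 2 := b)) (y(1 := c, 2 := d)) =
      (if P then f a b * cnj (f c d) else 0)" for a b c d
    by (auto simp: pair_tape_def P_def)
  have "pair_tape g x y = (if P then g (x 1) (x 2) * cnj (g (y 1) (y 2)) else 0)" for g
    by (simp add: pair_tape_def P_def)
  then show "apply_gate u 1 (pair_tape f) x y = pair_tape (gate_on_pair u f) x y"
    by (cases P) (simp_all add: apply_gate_def upd gate_on_pair_def sum_product split_def mult_ac)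
qed

lemma gate_on_pair_simps:
  "gate_on_pair Ident f a b = f a b"
  "gate_on_pair Hadamard f False b = (f False b + f True b) / complex_of_real (sqrt 2)"
  "gate_on_pair Hadamard f True b = (f False b - f True b) / complex_of_real (sqrt 2)"
  "gate_on_pair Pi8 f a b = (if a then cis (pi / 4) else 1) * f a b"
  "gate_on_pair CNot f a b = f a (b \<noteq> a)"
  by (cases a; cases b; simp add: gate_on_pair_def sum_UNIV_bool_pair field_simps)+

text \<open>The kernel vanishes as soon as a cell other than 1 and 2 is set, so the infinite sum of
  the partial trace reduces to the term of the all-zero \<open>z\<close>.\<close>

lemma read_qtape_2_pair_tape:
  "read_qtape 2 (pair_tape f) =
     mat 4 4 (\<lambda>(i, j). f (bit i 1) (bit i 0) * cnj (f (bit j 1) (bit j 0)))"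
proof -
  have "(\<Sum>\<^sub>\<infinity>z\<in>{z. finite {c. z c} \<and> (\<forall>c\<in>{1..int 2}. \<not> z c)}.
      pair_tape f (set_cells 2 i z) (set_cells 2 j z)) =
    f (bit i 1) (bit i 0) * cnj (f (bit j 1) (bit j 0))" for i j :: nat
  proof -
    let ?F = "\<lambda>z. pair_tape f (set_cells 2 i z) (set_cells 2 j z)"
    have "infsum ?F {z. finite {c. z c} \<and> (\<forall>c\<in>{1..int 2}. \<not> z c)} = infsum ?F {\<lambda>_. False}"
    proof (rule infsum_cong_neutral)
      fix z
      assume "z \<in> {z. finite {c. z c} \<and> (\<forall>c\<in>{1..int 2}. \<not> z c)} - {\<lambda>_. False}"
      then have "z \<noteq> (\<lambda>_. False)" and zero: "\<forall>c\<in>{1..2}. \<not> z c"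
        by auto
      then obtain c where "z c"
        by (meson ext)
      moreover from this zero have "c \<notin> {1..2}"
        by blast
      ultimately have "\<exists>c. z c \<and> c \<notin> {1..2}"
        by blast
      then show "?F z = 0"
        by (auto simp: pair_tape_def set_cells_def)
    qed auto
    also have "\<dots> = ?F (\<lambda>_. False)"
      by simp
    also have "\<dots> = f (bit i 1) (bit i 0) * cnj (f (bit j 1) (bit j 0))"
    proof -
      have "c \<noteq> 1 \<Longrightarrow> c \<noteq> 2 \<Longrightarrow> \<not> set_cells 2 k (\<lambda>_. False) c"
        "set_cells 2 k (\<lambda>_. False) 1 = bit k 1" "set_cells 2 k (\<lambda>_. False) 2 = bit k 0" for k c
        by (auto simp: set_cells_def split: if_splits)
      then show ?thesis
        by (simp add: pair_tape_def)
    qed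
    finally show ?thesis .
  qed
  then show ?thesis
    by (simp add: read_qtape_def)
qed

lemma read_qtape_1_pair_tape:
  "read_qtape 1 (pair_tape f) =
     mat 2 2 (\<lambda>(i, j). \<Sum>b\<in>UNIV. f (bit i 0) b * cnj (f (bit j 0) b))"
proof -
  have "(\<Sum>\<^sub>\<infinity>z\<in>{z. finite {c. z c} \<and> (\<forall>c\<in>{1..int 1}. \<not> z c)}.
      pair_tape f (set_cells 1 i z) (set_cells 1 j z)) =
    (\<Sum>b\<in>UNIV. f (bit i 0) b * cnj (f (bit j 0) b))" for i j :: nat
  proof -
    let ?F = "\<lambda>z. pair_tape f (set_cells 1 i z) (set_cells 1 j z)"
    \<comment> \<open>The two basis states that survive in the sum: only cell 2, which is now traced
      out, may be set.\<close>
    let ?e = "\<lambda>b::bool. (\<lambda>_. False)(2 := b) :: qbasis"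
    have "finite {c. ?e b c}" for b
      by (rule finite_subset[of _ "{2}"]) (auto split: if_splits)
    then have range_e: "range ?e \<subseteq> {z. finite {c. z c} \<and> (\<forall>c\<in>{1..int 1}. \<not> z c)}"
      by auto
    have "infsum ?F {z. finite {c. z c} \<and> (\<forall>c\<in>{1..int 1}. \<not> z c)} = infsum ?F (range ?e)"
    proof (rule infsum_cong_neutral)
      fix z
      assume z: "z \<in> {z. finite {c. z c} \<and> (\<forall>c\<in>{1..int 1}. \<not> z c)} - range ?e"
      have "\<exists>c. z c \<and> c \<noteq> 1 \<and> c \<noteq> 2"
      proof (rule ccontr)
        assume "\<not> ?thesis"
        then have "z = ?e (z 2)"
          using z by (intro ext) auto
        then show False
          using z by blast
      qed
      then show "?F z = 0"
        by (auto simp: pair_tape_def set_cells_def)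
    qed (use range_e in blast)+
    also have "\<dots> = (\<Sum>b\<in>UNIV. ?F (?e b))"
      by (subst infsum_finite) (auto simp: sum.reindex inj_def fun_eq_iff)
    also have "\<dots> = (\<Sum>b\<in>UNIV. f (bit i 0) b * cnj (f (bit j 0) b))"
      by (intro sum.cong) (auto simp: pair_tape_def set_cells_def)
    finally show ?thesis .
  qed
  then show ?thesis
    by (simp add: read_qtape_def)
qed

section \<open>Rotated Bell states\<close>

text \<open>Every unitary with first column \<open>(\<alpha>, \<beta>)\<close>, up to a common factor, has this form,
  with \<open>u\<close> its determinant.\<close>

definition su_kernel :: "complex \<Rightarrow> complex \<Rightarrow> complex \<Rightarrow> bool \<Rightarrow> bool \<Rightarrow> complex" where
  "su_kernel \<alpha> \<beta> u = (\<lambda>a b. if b then (if a then u * cnj \<alpha> else - (u * cnj \<beta>))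
                              else (if a then \<beta> else \<alpha>))"

text \<open>The triple \<open>(\<alpha>, \<beta>, u)\<close> of the \<open>t\<close>-th power of (Hadamard after \<open>\<pi>/8\<close>), scaled by the
  normalisation of the Bell state.\<close>

fun amplitudes :: "nat \<Rightarrow> complex \<times> complex \<times> complex" where
  "amplitudes 0 = (1 / complex_of_real (sqrt 2), 0, 1)"
| "amplitudes (Suc t) =
     (let (\<alpha>, \<beta>, u) = amplitudes t
      in ((\<alpha> + cis (pi / 4) * \<beta>) / complex_of_real (sqrt 2),
          (\<alpha> - cis (pi / 4) * \<beta>) / complex_of_real (sqrt 2), - cis (pi / 4) * u))"

definition rotated_bell :: "nat \<Rightarrow> bool \<Rightarrow> bool \<Rightarrow> complex" where
  "rotated_bell t = (case amplitudes t of (\<alpha>, \<beta>, u) \<Rightarrow> su_kernel \<alpha> \<beta> u)"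

definition rotated_bell_state :: "nat \<Rightarrow> complex mat" where
  "rotated_bell_state t = mat 4 4 (\<lambda>(i, j).
     rotated_bell t (bit i 1) (bit i 0) * cnj (rotated_bell t (bit j 1) (bit j 0)))"

definition mixed_qubit :: "complex mat" where
  "mixed_qubit = mat 2 2 (\<lambda>(i, j). if i = j then 1 / 2 else 0)"

text \<open>The value 1/2 is the squared normalisation of the Bell state. It is preserved because
  the phase factor has modulus one and the cross terms produced by the Hadamard gate cancel.\<close>

lemma norm_amplitudes:
  assumes "amplitudes t = (\<alpha>, \<beta>, u)"
  shows "\<alpha> * cnj \<alpha> + \<beta> * cnj \<beta> = 1 / 2" "u * cnj u = 1"
  using assms
proof (induction t arbitrary: \<alpha> \<beta> u)
  case 0
  {
    case 1
    then show ?case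
      by (auto simp flip: of_real_mult)
  next
    case 2
    then show ?case
      by auto
  }
next
  case (Suc t)
  obtain \<alpha>0 \<beta>0 u0 where t: "amplitudes t = (\<alpha>0, \<beta>0, u0)"
    by (cases "amplitudes t")
  have cis: "cis (pi / 4) * cnj (cis (pi / 4)) = 1"
    by (simp add: cis_cnj flip: cis_inverse)
  have sqrt2: "complex_of_real (sqrt 2) * complex_of_real (sqrt 2) = 2"
    by (simp flip: of_real_mult)
  {
    case 1
    then have "\<alpha> * cnj \<alpha> + \<beta> * cnj \<beta> =
      (2 * (\<alpha>0 * cnj \<alpha>0) + 2 * (cis (pi / 4) * cnj (cis (pi / 4))) * (\<beta>0 * cnj \<beta>0)) / 2"
      by (auto simp: t algebra_simps simp flip: sqrt2 add_divide_distrib)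
    also have "\<dots> = \<alpha>0 * cnj \<alpha>0 + \<beta>0 * cnj \<beta>0"
      unfolding cis by simp
    finally show ?case
      using Suc.IH(1)[OF t] by simp
  next
    case 2
    then have "u * cnj u = (cis (pi / 4) * cnj (cis (pi / 4))) * (u0 * cnj u0)"
      by (auto simp: t algebra_simps)
    then show ?case
      using Suc.IH(2)[OF t] unfolding cis by simp
  }
qed

text \<open>As a matrix, \<open>rotated_bell t\<close> is a unitary divided by \<surd>2.
  Orthogonality of its rows gives the marginal of the first qubit, orthogonality of its columns that
  of the second.\<close>

lemma rotated_bell_unitary:
  "(\<Sum>b\<in>UNIV. rotated_bell t a b * cnj (rotated_bell t a' b)) = (if a = a' then 1 / 2 else 0)"
  "(\<Sum>a\<in>UNIV. rotated_bell t a b * cnj (rotated_bell t a b')) = (if b = b' then 1 / 2 else 0)"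
proof -
  obtain \<alpha> \<beta> u where t: "amplitudes t = (\<alpha>, \<beta>, u)"
    by (cases "amplitudes t")
  note norm = norm_amplitudes[OF t]
  have uu: "u * x * (cnj u * y) = x * y" for x y
  proof -
    have "u * x * (cnj u * y) = (u * cnj u) * (x * y)"
      by (simp only: mult_ac)
    then show ?thesis
      by (simp add: norm(2))
  qed
  show "(\<Sum>b\<in>UNIV. rotated_bell t a b * cnj (rotated_bell t a' b)) = (if a = a' then 1 / 2 else 0)"
    by (cases a; cases a'; simp add: rotated_bell_def t su_kernel_def UNIV_bool uu)
      (use norm(1) in \<open>simp_all add: mult.commute add.commute\<close>)
  show "(\<Sum>a\<in>UNIV. rotated_bell t a b * cnj (rotated_bell t a b')) = (if b = b' then 1 / 2 else 0)"
    by (cases b; cases b'; simp add: rotated_bell_def t su_kernel_def UNIV_bool uu)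
      (use norm(1) in \<open>simp_all add: mult.commute mult.left_commute add.commute\<close>)
qed

lemma rotated_bell_state_index:
  assumes "i < 2" "k < 2" "j < 2" "l < 2"
  shows "rotated_bell_state t $$ (2 * i + k, 2 * j + l) =
    rotated_bell t (i = 1) (k = 1) * cnj (rotated_bell t (j = 1) (l = 1))"
proof -
  have "bit (2 * i + k) 0 = (k = 1)" "bit (2 * i + k) 1 = (i = 1)"
    if "i < 2" "k < 2" for i k :: nat
    using that by (auto simp: less_2_cases_iff bit_iff_odd)
  then show ?thesis
    using assms by (simp add: rotated_bell_state_def)
qed

lemma reduced_rotated_bell:
  "reduced_first 1 1 (rotated_bell_state t) = mixed_qubit"
  "reduced_last 1 1 (rotated_bell_state t) = mixed_qubit"
proof -
  have sum2: "(\<Sum>k<2. g (k = (1::nat))) = (\<Sum>b\<in>UNIV. g b)" for g :: "bool \<Rightarrow> complex"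
    by (simp add: numeral_2_eq_2 UNIV_bool)
  have eq_1_iff: "(i = 1) = (j = 1) \<longleftrightarrow> i = j" if "i < 2" "j < 2" for i j :: nat
    using that by (auto simp: less_2_cases_iff)
  have "(\<Sum>k<2. rotated_bell_state t $$ (2 * i + k, 2 * j + k)) = (if i = j then 1 / 2 else 0)"
    if "i < 2" "j < 2" for i j
  proof -
    have "(\<Sum>k<2. rotated_bell_state t $$ (2 * i + k, 2 * j + k)) =
        (\<Sum>k<2. rotated_bell t (i = 1) (k = (1::nat)) * cnj (rotated_bell t (j = 1) (k = 1)))"
      using that by (intro sum.cong refl rotated_bell_state_index) auto
    then show ?thesis
      unfolding sum2[of "\<lambda>b. rotated_bell t (i = 1) b * cnj (rotated_bell t (j = 1) b)"]
        rotated_bell_unitary eq_1_iff[OF that] .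
  qed
  then show "reduced_first 1 1 (rotated_bell_state t) = mixed_qubit"
    by (intro eq_matI) (auto simp: reduced_first_def mixed_qubit_def mult.commute)
  have "(\<Sum>k<2. rotated_bell_state t $$ (2 * k + i, 2 * k + j)) = (if i = j then 1 / 2 else 0)"
    if "i < 2" "j < 2" for i j
  proof -
    have "(\<Sum>k<2. rotated_bell_state t $$ (2 * k + i, 2 * k + j)) =
        (\<Sum>k<2. rotated_bell t (k = (1::nat)) (i = 1) * cnj (rotated_bell t (k = 1) (j = 1)))"
      using that by (intro sum.cong refl rotated_bell_state_index) auto
    then show ?thesis
      unfolding sum2[of "\<lambda>b. rotated_bell t b (i = 1) * cnj (rotated_bell t b (j = 1))"]
        rotated_bell_unitary eq_1_iff[OF that] .
  qed
  then show "reduced_last 1 1 (rotated_bell_state t) = mixed_qubit"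
    by (intro eq_matI) (auto simp: reduced_last_def mixed_qubit_def mult.commute)
qed

lemma qstate_rank_one:
  assumes "(\<Sum>i<2 ^ n. w i * cnj (w i)) = 1"
  shows "qstate n (mat (2 ^ n) (2 ^ n) (\<lambda>(i, j). w i * cnj (w j)))"
proof -
  let ?\<rho> = "mat (2 ^ n) (2 ^ n) (\<lambda>(i, j). w i * cnj (w j))"
  have "0 \<le> Re ((?\<rho> *\<^sub>v v) \<bullet>c v)" if v: "v \<in> carrier_vec (2 ^ n)" for v
  proof -
    have "(?\<rho> *\<^sub>v v) \<bullet>c v = (\<Sum>i<2 ^ n. \<Sum>j<2 ^ n. w i * cnj (w j) * v $ j * cnj (v $ i))"
      using v by (auto simp: scalar_prod_def sum_distrib_right atLeast0LessThan intro!: sum.cong)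
    \<comment> \<open>The quadratic form of a rank-one matrix is the squared modulus of an inner
      product.\<close>
    also have "\<dots> = (\<Sum>i<2 ^ n. w i * cnj (v $ i)) * cnj (\<Sum>i<2 ^ n. w i * cnj (v $ i))"
      by (simp add: sum_product mult_ac)
    also have "Re \<dots> \<ge> 0"
      unfolding complex_norm_square[symmetric] by (simp del: of_real_power)
    finally show ?thesis .
  qed
  moreover have "mat_adjoint ?\<rho> = ?\<rho>"
    by (rule eq_matI) (auto simp: mat_adjoint_index carrier_matD[OF mat_adjoint_carrier[OF mat_carrier]])
  moreover have "mat_trace ?\<rho> = 1"
    using assms by (simp add: mat_trace_def)
  ultimately show ?thesis
    by (simp add: qstate_def)
qed

lemma qstate_rotated_bell_state: "qstate 2 (rotated_bell_state t)"
proof -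
  let ?w = "\<lambda>i::nat. rotated_bell t (bit i 1) (bit i 0)"
  have "(\<Sum>i<4. ?w i * cnj (?w i)) =
    (\<Sum>a\<in>UNIV. \<Sum>b\<in>UNIV. rotated_bell t a b * cnj (rotated_bell t a b))"
  proof -
    have "{..<4::nat} = {0, 1, 2, 3}"
      by auto
    then show ?thesis
      by (simp add: UNIV_bool bit_iff_odd)
  qed
  also have "\<dots> = 1"
    by (simp add: rotated_bell_unitary)
  finally show ?thesis
    using qstate_rank_one[of ?w 2] by (simp add: rotated_bell_state_def)
qed

lemma qstate_empty_state: "qstate 0 empty_state"
proof -
  have "mat 1 1 (\<lambda>(i, j). 1) = empty_state"
    by (rule eq_matI) (auto simp: empty_state_def)
  then show ?thesis
    using qstate_rank_one[of "\<lambda>_. 1" 0] by simp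
qed

section \<open>Machines that prepare rotated Bell states\<close>

lemma gate_on_pair_Ident: "gate_on_pair Ident f = f"
  by (intro ext) (simp add: gate_on_pair_simps)

lemma rotated_bell_0:
  "gate_on_pair CNot (gate_on_pair Hadamard (\<lambda>a b. of_bool (\<not> a \<and> \<not> b))) = rotated_bell 0"
proof (intro ext)
  fix a b
  show "gate_on_pair CNot (gate_on_pair Hadamard (\<lambda>a b. of_bool (\<not> a \<and> \<not> b))) a b = rotated_bell 0 a b"
    by (cases a; cases b) (simp_all add: gate_on_pair_simps rotated_bell_def su_kernel_def)
qed

text \<open>The gates act on each column separately. The second column keeps the shape required by
  \<open>su_kernel\<close> because \<open>u\<close> is multiplied by the determinant
  \<open>- cis (pi / 4)\<close> of the rotation.\<close>

lemma rotated_bell_Suc: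
  "gate_on_pair Hadamard (gate_on_pair Pi8 (rotated_bell t)) = rotated_bell (Suc t)"
proof (intro ext)
  fix a b
  obtain \<alpha> \<beta> u where t: "amplitudes t = (\<alpha>, \<beta>, u)"
    by (cases "amplitudes t")
  have cis: "cis (pi / 4) * cnj (cis (pi / 4)) = 1"
    by (simp add: cis_cnj flip: cis_inverse)
  show "gate_on_pair Hadamard (gate_on_pair Pi8 (rotated_bell t)) a b = rotated_bell (Suc t) a b"
    by (cases a; cases b)
      (simp_all add: gate_on_pair_simps rotated_bell_def su_kernel_def t cis algebra_simps
        minus_divide_left)
qed

text \<open>The symbols \<open>1 # w\<close> on the classical tape are the binary number of output qubits.\<close>

definition bell_program :: "sym list \<Rightarrow> nat \<Rightarrow> sl_instr list" where
  "bell_program w t =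
     [(Ident, MoveR, Blank, MoveR), (Hadamard, Stay, Blank, MoveR), (CNot, Stay, Sym1, MoveR)]
     @ map (\<lambda>a. (Ident, Stay, a, MoveR)) w @ [(Ident, Stay, Blank, Stay)]
     @ concat (replicate t [(Pi8, Stay, Blank, Stay), (Hadamard, Stay, Blank, Stay)])"

text \<open>The classical head rests on a blank cell and rewrites it with a blank, so each round
  changes only the quantum tape.\<close>

lemma fold_exec_rotations:
  assumes "qtape c = pair_tape (rotated_bell s)" "qhead c = 1" "ctape c (chead c) = Blank"
    and "c' = fold exec_instr
      (concat (replicate t [(Pi8, Stay, Blank, Stay), (Hadamard, Stay, Blank, Stay)])) c"
  shows "qtape c' = pair_tape (rotated_bell (s + t)) \<and> ctape c' = ctape c"
  using assms
proof (induction t arbitrary: s c)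
  case (Suc t)
  define d where
    "d = exec_instr (Hadamard, Stay, Blank, Stay) (exec_instr (Pi8, Stay, Blank, Stay) c)"
  have "qtape d = pair_tape (rotated_bell (Suc s))" "qhead d = 1" "ctape d (chead d) = Blank"
    "ctape d = ctape c"
    using Suc.prems(1-3) by (simp_all add: d_def apply_gate_pair_tape rotated_bell_Suc fun_upd_idem)
  moreover have "c' = fold exec_instr
      (concat (replicate t [(Pi8, Stay, Blank, Stay), (Hadamard, Stay, Blank, Stay)])) d"
    using Suc.prems(4) by (simp only: d_def replicate_Suc concat.simps fold_append fold_simps comp_apply)
  ultimately show ?case
    using Suc.IH[of d "Suc s"] by simp
qed simp_all

text \<open>With \<open>[Sym0]\<close> the output length reads 10 in binary and both qubits are
  output; with \<open>[]\<close> it reads 1 and only one half of the Bell pair is output. The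
  delimiting blanks are written explicitly, so the input \<open>x\<close> cannot interfere.\<close>

lemma dcq_run_bell_program:
  "dcq_run (straight_line (bell_program [Sym0] t)) x 0 empty_state =
     Some ([], rotated_bell_state t)"
  "dcq_run (straight_line (bell_program [] 0)) x 0 empty_state = Some ([], mixed_qubit)"
proof -
  have word: "word_at T 2 = [True, False]"
    if "T 2 = Sym1" "T 3 = Sym0" "T 4 = Blank" for T
  proof -
    have "\<exists>k. T (2 + int k) = Blank" "\<exists>k. T (3 + int k) = Blank"
      using that by (auto intro: exI[of _ 2] exI[of _ 1])
    then show ?thesis
      using that by (simp add: word_at_nonblank word_at_blank)
  qed
  let ?c = "dcq_init (straight_line (bell_program [Sym0] t)) x 0 empty_state"
  \<comment> \<open>The configuration once the Bell pair and the output length are in place, before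
    any rotation.\<close>
  let ?c' = "fold exec_instr [(Ident, MoveR, Blank, MoveR), (Hadamard, Stay, Blank, MoveR),
    (CNot, Stay, Sym1, MoveR), (Ident, Stay, Sym0, MoveR), (Ident, Stay, Blank, Stay)] ?c"
  have c': "qtape ?c' = pair_tape (rotated_bell 0)" "qhead ?c' = 1" "ctape ?c' (chead ?c') = Blank"
    "ctape ?c' 1 = Blank" "ctape ?c' 2 = Sym1" "ctape ?c' 3 = Sym0" "ctape ?c' 4 = Blank"
    by (simp_all add: dcq_init_def qtape_of_empty_state apply_gate_Ident apply_gate_pair_tape
        gate_on_pair_Ident rotated_bell_0)
  let ?d = "fold exec_instr (bell_program [Sym0] t) ?c"
  have d: "?d = fold exec_instr
      (concat (replicate t [(Pi8, Stay, Blank, Stay), (Hadamard, Stay, Blank, Stay)])) ?c'"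
    by (simp add: bell_program_def)
  have "qtape ?d = pair_tape (rotated_bell t)" "ctape ?d = ctape ?c'"
    unfolding d using fold_exec_rotations[OF c'(1-3) refl, of t] by simp_all
  moreover from this have "ctape ?d 1 = Blank" "ctape ?d 2 = Sym1" "ctape ?d 3 = Sym0"
    "ctape ?d 4 = Blank"
    by (simp_all only: c')
  moreover have "bin_val [True, False] = 2"
    by (simp add: bin_val_def)
  ultimately have "dcq_output ?d = ([], rotated_bell_state t)"
    by (simp add: dcq_output_def word_at_blank word read_qtape_2_pair_tape rotated_bell_state_def)
  then show "dcq_run (straight_line (bell_program [Sym0] t)) x 0 empty_state =
     Some ([], rotated_bell_state t)"
    by (simp add: dcq_run_straight_line)
  have word1: "word_at T 2 = [True]" if "T 2 = Sym1" "T 3 = Blank" for T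
  proof -
    have "\<exists>k. T (2 + int k) = Blank"
      using that by (auto intro: exI[of _ 1])
    then show ?thesis
      using that by (simp add: word_at_nonblank word_at_blank)
  qed
  have "mixed_qubit = read_qtape 1 (pair_tape (rotated_bell 0))"
    unfolding read_qtape_1_pair_tape mixed_qubit_def rotated_bell_unitary
    by (intro eq_matI) (auto simp: less_2_cases_iff bit_iff_odd)
  then show "dcq_run (straight_line (bell_program [] 0)) x 0 empty_state = Some ([], mixed_qubit)"
    by (simp add: dcq_run_straight_line bell_program_def dcq_init_def qtape_of_empty_state
        apply_gate_Ident apply_gate_pair_tape gate_on_pair_Ident rotated_bell_0 dcq_output_def word_at_blank word1
        bin_val_def)
qed

section \<open>The rotated Bell states are pairwise distinct\<close>

text \<open>The multiples of \<surd>2 in \<int>[\<surd>2], since 2 a + b \<surd>2 = \<surd>2 (b + a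
  \<surd>2); \<open>odd_sqrt2\<close> is the other residue class modulo \<surd>2.\<close>

definition even_sqrt2 :: "real \<Rightarrow> bool" where
  "even_sqrt2 x \<longleftrightarrow> (\<exists>a b :: int. x = 2 * of_int a + of_int b * sqrt 2)"

definition odd_sqrt2 :: "real \<Rightarrow> bool" where
  "odd_sqrt2 x \<longleftrightarrow> (\<exists>a b :: int. x = 2 * of_int a + 1 + of_int b * sqrt 2)"

lemma even_sqrt2_mult_sqrt2:
  assumes "even_sqrt2 x \<or> odd_sqrt2 x"
  shows "even_sqrt2 (sqrt 2 * x)"
proof -
  obtain a b :: int where "x = of_int a + of_int b * sqrt 2"
    using assms unfolding even_sqrt2_def odd_sqrt2_def
    by (metis of_int_1 of_int_add of_int_mult of_int_numeral)
  then have "sqrt 2 * x = 2 * of_int b + of_int a * sqrt 2"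
    by (simp add: algebra_simps)
  then show ?thesis
    unfolding even_sqrt2_def by blast
qed

lemma odd_sqrt2_simps:
  assumes "even_sqrt2 x" "odd_sqrt2 y"
  shows "odd_sqrt2 (x - y)" "odd_sqrt2 (- (x + y))"
proof -
  obtain a b c d :: int where xy: "x = 2 * of_int a + of_int b * sqrt 2"
    "y = 2 * of_int c + 1 + of_int d * sqrt 2"
    using assms unfolding even_sqrt2_def odd_sqrt2_def by blast
  then have "x - y = 2 * of_int (a - c - 1) + 1 + of_int (b - d) * sqrt 2"
    "- (x + y) = 2 * of_int (- a - c - 1) + 1 + of_int (- b - d) * sqrt 2"
    by (simp_all add: algebra_simps)
  then show "odd_sqrt2 (x - y)" "odd_sqrt2 (- (x + y))"
    unfolding odd_sqrt2_def by blast+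
qed

text \<open>A common value would make an odd integer equal to an integer multiple of \<surd>2; after
  squaring, an odd number equals an even one.\<close>

lemma not_even_and_odd_sqrt2: "even_sqrt2 x \<Longrightarrow> \<not> odd_sqrt2 x"
proof
  assume "even_sqrt2 x" "odd_sqrt2 x"
  then obtain a b c d :: int where
    "2 * real_of_int a + of_int b * sqrt 2 = 2 * of_int c + 1 + of_int d * sqrt 2"
    unfolding even_sqrt2_def odd_sqrt2_def by auto
  then have "real_of_int (b - d) * sqrt 2 = of_int (2 * (c - a) + 1)"
    by (simp add: algebra_simps)
  then have "(real_of_int (b - d))\<^sup>2 * 2 = (of_int (2 * (c - a) + 1))\<^sup>2"
    by (metis power_mult_distrib real_sqrt_pow2 zero_le_numeral)
  then have "real_of_int ((b - d)\<^sup>2 * 2) = of_int ((2 * (c - a) + 1)\<^sup>2)"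
    by simp
  then have "(b - d)\<^sup>2 * 2 = (2 * (c - a) + 1)\<^sup>2"
    by (simp only: of_int_eq_iff)
  then have "even ((2 * (c - a) + 1)\<^sup>2)"
    by (metis dvd_triv_right)
  then show False
    by simp
qed

text \<open>The factors 4 and 2, in place of the usual 2 and 1, undo the normalisation of the Bell
  state.\<close>

definition bloch :: "nat \<Rightarrow> real \<times> real \<times> real" where
  "bloch t = (case amplitudes t of (\<alpha>, \<beta>, u) \<Rightarrow>
     (4 * Re (cnj \<alpha> * \<beta>), 4 * Im (cnj \<alpha> * \<beta>), 2 * Re (\<alpha> * cnj \<alpha> - \<beta> * cnj \<beta>)))"

lemma bloch_0: "bloch 0 = (0, 0, 1)"
  by (simp add: bloch_def power2_eq_square flip: of_real_mult)

text \<open>The gate \<open>Pi8\<close> rotates by an angle of \<pi>/4 about the z axis; the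
  Hadamard gate then exchanges x and z and negates y.\<close>

lemma bloch_Suc:
  assumes "bloch t = (x, y, z)"
  shows "bloch (Suc t) = (z, - (x + y) / sqrt 2, (x - y) / sqrt 2)"
proof -
  obtain \<alpha> \<beta> u where t: "amplitudes t = (\<alpha>, \<beta>, u)"
    by (cases "amplitudes t")
  \<comment> \<open>The second amplitude between the two gates.\<close>
  define \<gamma> where "\<gamma> = cis (pi / 4) * \<beta>"
  have norm: "\<gamma> * cnj \<gamma> = \<beta> * cnj \<beta>"
    by (simp add: \<gamma>_def norm_mult del: complex_cnj_mult flip: complex_norm_square)
  have mult: "Re (cnj \<alpha> * \<gamma>) = (Re (cnj \<alpha> * \<beta>) - Im (cnj \<alpha> * \<beta>)) / sqrt 2"
    "Im (cnj \<alpha> * \<gamma>) = (Re (cnj \<alpha> * \<beta>) + Im (cnj \<alpha> * \<beta>)) / sqrt 2"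
    by (simp_all add: \<gamma>_def cos_45 sin_45 field_simps)
  have "bloch (Suc t) =
    (2 * Re (\<alpha> * cnj \<alpha> - \<gamma> * cnj \<gamma>), - 4 * Im (cnj \<alpha> * \<gamma>), 4 * Re (cnj \<alpha> * \<gamma>))"
  proof -
    have half: "cnj (v / complex_of_real (sqrt 2)) * (w / complex_of_real (sqrt 2)) = cnj v * w / 2"
      "v / complex_of_real (sqrt 2) * cnj (w / complex_of_real (sqrt 2)) = v * cnj w / 2" for v w
      by (simp_all flip: of_real_mult)
    have "amplitudes (Suc t) = ((\<alpha> + \<gamma>) / complex_of_real (sqrt 2),
        (\<alpha> - \<gamma>) / complex_of_real (sqrt 2), - cis (pi / 4) * u)"
      by (simp add: t \<gamma>_def)
    then have "bloch (Suc t) = (4 * Re (cnj (\<alpha> + \<gamma>) * (\<alpha> - \<gamma>) / 2), 4 * Im (cnj (\<alpha> + \<gamma>) * (\<alpha> - \<gamma>) / 2),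
        2 * Re ((\<alpha> + \<gamma>) * cnj (\<alpha> + \<gamma>) / 2 - (\<alpha> - \<gamma>) * cnj (\<alpha> - \<gamma>) / 2))"
      by (simp only: bloch_def prod.case half)
    then show ?thesis
      by (simp add: field_simps)
  qed
  also have "\<dots> = (2 * Re (\<alpha> * cnj \<alpha> - \<beta> * cnj \<beta>),
      - (4 * Re (cnj \<alpha> * \<beta>) + 4 * Im (cnj \<alpha> * \<beta>)) / sqrt 2,
      (4 * Re (cnj \<alpha> * \<beta>) - 4 * Im (cnj \<alpha> * \<beta>)) / sqrt 2)"
    unfolding norm mult by (simp only: prod.inject) (simp add: field_simps)
  finally show ?thesis
    using assms by (simp only: bloch_def t prod.case prod.inject)
qed

lemma bloch_form:
  "\<exists>x y z. bloch (t + 2) = (x / sqrt 2 ^ Suc t, y / sqrt 2 ^ Suc t, z / sqrt 2 ^ Suc t) \<and>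
     even_sqrt2 x \<and> odd_sqrt2 y \<and> odd_sqrt2 z"
proof (induction t)
  case 0
  \<comment> \<open>The vector passes from (0, 0, 1) through (1, 0, 0); only after two steps do y
    and z have odd numerators, hence the shift by 2.\<close>
  have "bloch 2 = (0 / sqrt 2, -1 / sqrt 2, 1 / sqrt 2)"
    using bloch_Suc[OF bloch_Suc[OF bloch_0]] by (simp add: numeral_2_eq_2)
  moreover have "even_sqrt2 0"
    unfolding even_sqrt2_def by (intro exI[of _ 0]) simp
  moreover have "odd_sqrt2 (- 1)"
    unfolding odd_sqrt2_def by (rule exI[of _ "-1"], rule exI[of _ 0]) simp
  moreover have "odd_sqrt2 1"
    unfolding odd_sqrt2_def by (intro exI[of _ 0]) simp
  ultimately have "bloch (0 + 2) = (0 / sqrt 2 ^ Suc 0, - 1 / sqrt 2 ^ Suc 0, 1 / sqrt 2 ^ Suc 0) \<and>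
      even_sqrt2 0 \<and> odd_sqrt2 (- 1) \<and> odd_sqrt2 1"
    by (simp add: numeral_2_eq_2)
  then show ?case
    by blast
next
  case (Suc t)
  then obtain x y z where
    IH: "bloch (t + 2) = (x / sqrt 2 ^ Suc t, y / sqrt 2 ^ Suc t, z / sqrt 2 ^ Suc t)"
      "even_sqrt2 x" "odd_sqrt2 y" "odd_sqrt2 z"
    by blast
  \<comment> \<open>The denominator gains one factor \<surd>2. The new x, which is the old z, is
    expanded by it and so becomes even.\<close>
  have "bloch (Suc t + 2) = (sqrt 2 * z / sqrt 2 ^ Suc (Suc t), - (x + y) / sqrt 2 ^ Suc (Suc t),
      (x - y) / sqrt 2 ^ Suc (Suc t))"
  proof -
    have "(z / s, - (x / s + y / s) / sqrt 2, (x / s - y / s) / sqrt 2) =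
        (sqrt 2 * z / (sqrt 2 * s), - (x + y) / (sqrt 2 * s), (x - y) / (sqrt 2 * s))" for s
      by (cases "s = 0") (simp_all add: field_simps)
    from this[of "sqrt 2 ^ Suc t"] show ?thesis
      using bloch_Suc[OF IH(1)] by simp
  qed
  then show ?case
    using even_sqrt2_mult_sqrt2[of z] odd_sqrt2_simps[OF IH(2,3)] IH(4) by blast
qed

text \<open>The diagonal entries 0 and 2 belong to the basis states 00 and 10, whose amplitudes are
  \<alpha> and \<beta>. Hence equal states have equal z components.\<close>

lemma bloch_rotated_bell_state:
  "snd (snd (bloch t)) = 2 * Re (rotated_bell_state t $$ (0, 0) - rotated_bell_state t $$ (2, 2))"
proof -
  obtain \<alpha> \<beta> u where t: "amplitudes t = (\<alpha>, \<beta>, u)"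
    by (cases "amplitudes t")
  have "rotated_bell_state t $$ (0, 0) = \<alpha> * cnj \<alpha>" "rotated_bell_state t $$ (2, 2) = \<beta> * cnj \<beta>"
    using rotated_bell_state_index[of 0 0 0 0 t] rotated_bell_state_index[of 1 0 1 0 t]
    by (simp_all add: rotated_bell_def su_kernel_def t)
  then show ?thesis
    by (simp add: bloch_def t)
qed

lemma inj_rotated_bell_state: "inj (\<lambda>t. rotated_bell_state (t + 2))"
proof (rule linorder_injI)
  fix s t :: nat
  assume "s < t"
  show "rotated_bell_state (s + 2) \<noteq> rotated_bell_state (t + 2)"
  proof
    assume eq: "rotated_bell_state (s + 2) = rotated_bell_state (t + 2)"
    obtain z where z: "snd (snd (bloch (s + 2))) = z / sqrt 2 ^ Suc s" "odd_sqrt2 z"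
      using bloch_form[of s] by fastforce
    obtain z' where z': "snd (snd (bloch (t + 2))) = z' / sqrt 2 ^ Suc t" "odd_sqrt2 z'"
      using bloch_form[of t] by fastforce
    obtain d where d: "t = s + Suc d"
      using less_imp_Suc_add[OF \<open>s < t\<close>] by auto
    have "z / sqrt 2 ^ Suc s = z' / sqrt 2 ^ Suc t"
      using z(1) z'(1) by (simp only: bloch_rotated_bell_state eq)
    \<comment> \<open>The denominators differ by at least one factor \<surd>2, which would make the
      odd \<open>z'\<close> even.\<close>
    then have "z' = sqrt 2 ^ Suc d * z"
      by (simp add: d power_add field_simps)
    moreover have "even_sqrt2 (sqrt 2 ^ Suc d * z)"
    proof (induction d)
      case 0
      then show ?case
        using even_sqrt2_mult_sqrt2 z(2) by simp
    next
      case (Suc d)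
      then show ?case
        using even_sqrt2_mult_sqrt2[of "sqrt 2 ^ Suc d * z"] by (simp add: mult.assoc)
    qed
    ultimately show False
      using not_even_and_odd_sqrt2 z'(2) by blast
  qed
qed

section \<open>Complexities\<close>

text \<open>A single \<open>p\<close> serves every \<open>y\<close>, so the same program works for
  all precisions and all conditioning strings.\<close>

lemma universal_program_of_constant:
  assumes "universal_dcq_TM U" "dcq_TM V" and "\<sigma> \<in> carrier_mat n n"
    and "\<And>x. dcq_run V x 0 empty_state = Some (w, \<sigma>)"
  obtains p where "\<And>y \<delta>. 0 \<le> \<delta> \<Longrightarrow> outputs_within U (tuple [p, y]) \<sigma> \<delta>"
proof -
  obtain s where "\<forall>p y n \<rho>. qstate n \<rho> \<longrightarrow>
      dcq_run U (tuple [s p, y]) n \<rho> = dcq_run V (tuple [p, y]) n \<rho>"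
    using assms(1)[unfolded universal_dcq_TM_def, THEN conjunct2, rule_format, OF assms(2)] by metis
  then have "dcq_run U (tuple [s p, y]) 0 empty_state = dcq_run V (tuple [p, y]) 0 empty_state" for p y
    using qstate_empty_state by (simp del: tuple.simps)
  then have "dcq_run U (tuple [s [], y]) 0 empty_state = Some (w, \<sigma>)" for y
    using assms(4) by (simp del: tuple.simps)
  \<comment> \<open>The output is exact, so its distance 0 meets every tolerance.\<close>
  then have "outputs_within U (tuple [s [], y]) \<sigma> \<delta>" if "0 \<le> \<delta>" for y \<delta>
    using that trace_dist_self[OF assms(3)] unfolding outputs_within_def by auto
  then show ?thesis
    using that by blast
qed

lemma K_finite_of_constant:
  assumes "universal_dcq_TM U" "dcq_TM V" "\<sigma> \<in> carrier_mat n n"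
    and "\<And>x. dcq_run V x 0 empty_state = Some (w, \<sigma>)"
  shows "K U num \<sigma> < \<infinity>" "K_cond U num \<sigma> \<tau> < \<infinity>"
proof -
  obtain p where p: "\<And>y \<delta>. 0 \<le> \<delta> \<Longrightarrow> outputs_within U (tuple [p, y]) \<sigma> \<delta>"
    using universal_program_of_constant[OF assms] by blast
  have "\<forall>k\<ge>1. outputs_within U (tuple [p, num k]) \<sigma> (1 / real k)"
    using p by simp
  then have "K U num \<sigma> \<le> enat (length p)"
    unfolding K_def by (intro INF_lower) simp
  then show "K U num \<sigma> < \<infinity>"
    by (rule le_less_trans) simp
  \<comment> \<open>A triple is the pair of its first component and the tuple of the rest, so
    universality, stated for pairs, applies.\<close>
  have "outputs_within U (tuple [p, e, num k]) \<sigma> (1 / real k)" for e k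
    using p[of "1 / real k" "tuple [e, num k]"] by simp
  then have "K_cond U num \<sigma> \<tau> \<le> enat (length p)"
    unfolding K_cond_def by (intro INF_lower) simp
  then show "K_cond U num \<sigma> \<tau> < \<infinity>"
    by (rule le_less_trans) simp
qed

section \<open>Programs determine states, and counting them\<close>

lemma dcq_run_square:
  assumes "dcq_run T x n \<rho> = Some (y, \<sigma>)"
  shows "\<sigma> \<in> carrier_mat (dim_row \<sigma>) (dim_row \<sigma>)"
  using assms by (auto simp: dcq_run_def dcq_output_def Let_def read_qtape_def)

text \<open>Two states approximated by the same outputs have entries within 4/k of each other for
  every k: 2/k for each state, because the trace distance carries the factor 1/2.\<close>

lemma outputs_within_unique:
  assumes \<rho>: "\<rho> \<in> carrier_mat n n" and \<rho>': "\<rho>' \<in> carrier_mat n n"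
    and out: "\<And>k::nat. k \<ge> 1 \<Longrightarrow> outputs_within U (x k) \<rho> (1 / real k)"
      "\<And>k::nat. k \<ge> 1 \<Longrightarrow> outputs_within U (x k) \<rho>' (1 / real k)"
  shows "\<rho> = \<rho>'"
proof (rule eq_matI)
  fix i j
  assume "i < dim_row \<rho>'" "j < dim_col \<rho>'"
  then have ij: "i < n" "j < n"
    using \<rho>' by auto
  have "norm (\<rho> $$ (i, j) - \<rho>' $$ (i, j)) \<le> 4 * inverse (real (Suc k))" for k
  proof -
    obtain y \<sigma> where run: "dcq_run U (x (Suc k)) 0 empty_state = Some (y, \<sigma>)"
      "dim_row \<sigma> = n" "trace_dist \<sigma> \<rho> \<le> 1 / real (Suc k)"
      using out(1)[of "Suc k"] \<rho> unfolding outputs_within_def by auto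
    have "trace_dist \<sigma> \<rho>' \<le> 1 / real (Suc k)"
      using out(2)[of "Suc k"] run(1) unfolding outputs_within_def by auto
    \<comment> \<open>\<open>outputs_within\<close> compares only numbers of rows, but every output
      matrix is square.\<close>
    moreover have "\<sigma> \<in> carrier_mat n n"
      using dcq_run_square[OF run(1)] run(2) by simp
    ultimately have "norm (\<sigma> $$ (i, j) - \<rho> $$ (i, j)) \<le> 2 * (1 / real (Suc k))"
      "norm (\<sigma> $$ (i, j) - \<rho>' $$ (i, j)) \<le> 2 * (1 / real (Suc k))"
      using norm_index_diff_le_trace_dist[OF _ \<rho> ij] norm_index_diff_le_trace_dist[OF _ \<rho>' ij] run(3)
      by (meson mult_left_mono order.trans zero_le_numeral)+
    then have "norm ((\<sigma> $$ (i, j) - \<rho>' $$ (i, j)) - (\<sigma> $$ (i, j) - \<rho> $$ (i, j)))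
        \<le> 2 * (1 / real (Suc k)) + 2 * (1 / real (Suc k))"
      using norm_triangle_ineq4[of "\<sigma> $$ (i, j) - \<rho>' $$ (i, j)" "\<sigma> $$ (i, j) - \<rho> $$ (i, j)"]
      by linarith
    moreover have "2 * (1 / real (Suc k)) + 2 * (1 / real (Suc k)) = 4 * inverse (real (Suc k))"
      by (simp add: divide_inverse)
    ultimately show ?thesis
      by (simp add: algebra_simps del: of_nat_Suc)
  qed
  moreover have "(\<lambda>k. 4 * inverse (real (Suc k))) \<longlonglongrightarrow> 4 * 0"
    by (intro tendsto_intros LIMSEQ_inverse_real_of_nat)
  ultimately have "norm (\<rho> $$ (i, j) - \<rho>' $$ (i, j)) \<le> 4 * 0"
    using LIMSEQ_le_const by blast
  then show "\<rho> $$ (i, j) = \<rho>' $$ (i, j)"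
    by simp
qed (use \<rho> \<rho>' in auto)

lemma finite_K_le: "finite {\<rho> \<in> carrier_mat n n. K U num \<rho> \<le> enat L}"
proof -
  let ?S = "{\<rho> \<in> carrier_mat n n. K U num \<rho> \<le> enat L}"
  let ?prog = "\<lambda>p \<rho>. \<forall>k\<ge>1. outputs_within U (tuple [p, num k]) \<rho> (1 / real k)"
  have "\<exists>p. length p \<le> L \<and> ?prog p \<rho>" if "\<rho> \<in> ?S" for \<rho>
  proof -
    \<comment> \<open>A strict bound on the infimum yields an actual program below it.\<close>
    have "K U num \<rho> < enat (Suc L)"
      using that by (auto intro: le_less_trans)
    then show ?thesis
      unfolding K_def INF_less_iff by (auto simp: less_Suc_eq_le simp del: tuple.simps)
  qed
  then obtain f where f: "\<And>\<rho>. \<rho> \<in> ?S \<Longrightarrow> length (f \<rho>) \<le> L \<and> ?prog (f \<rho>) \<rho>"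
    by metis
  have "inj_on f ?S"
  proof (rule inj_onI)
    fix \<rho> \<rho>'
    assume "\<rho> \<in> ?S" "\<rho>' \<in> ?S" "f \<rho> = f \<rho>'"
    then show "\<rho> = \<rho>'"
      using f[of \<rho>] f[of \<rho>'] by (intro outputs_within_unique[of \<rho> n \<rho>' U "\<lambda>k. tuple [f \<rho>, num k]"]) auto
  qed
  moreover have "f ` ?S \<subseteq> {p. set p \<subseteq> UNIV \<and> length p \<le> L}"
    using f by auto
  ultimately show ?thesis
    using finite_lists_length_le[of "UNIV :: bool set" L] by (meson finite_UNIV finite_subset inj_on_finite)
qed

text \<open>Divide by \<open>N\<close>: as log (2 N) = 1 + log N, the right-hand side becomes
  \<open>(c + g) / N\<close> plus a multiple of \<open>ln N / N\<close>, which tends to 0 for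
  \<open>g\<close> of either sign.\<close>

lemma le_log_bounded:
  "\<exists>L. \<forall>N::nat. real N \<le> c + g * log 2 (2 * (if N = 0 then 1 else real N)) \<longrightarrow> N \<le> L"
proof -
  have "(\<lambda>N. (c + g) * inverse (real N) + g / ln 2 * (ln (real N) / real N)) \<longlonglongrightarrow>
      (c + g) * 0 + g / ln 2 * 0"
    by (intro tendsto_intros lim_inverse_n filterlim_compose[OF ln_x_over_x_tendsto_0 filterlim_real_sequentially])
  then have "\<forall>\<^sub>F N in sequentially.
      (c + g) * inverse (real N) + g / ln 2 * (ln (real N) / real N) < 1"
    by (rule order_tendstoD) simp
  then obtain L where L: "\<And>N. L \<le> N \<Longrightarrow>
      (c + g) * inverse (real N) + g / ln 2 * (ln (real N) / real N) < 1"
    unfolding eventually_sequentially by blast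
  have "N \<le> L" if N: "real N \<le> c + g * log 2 (2 * (if N = 0 then 1 else real N))" for N
  proof (rule ccontr)
    assume "\<not> N \<le> L"
    then have "N > 0" "L \<le> N"
      by auto
    have "c + g * log 2 (2 * real N) = c + g + g / ln 2 * ln (real N)"
      using \<open>N > 0\<close> by (simp add: log_def ln_mult field_simps)
    also have "\<dots> = real N * ((c + g) * inverse (real N) + g / ln 2 * (ln (real N) / real N))"
      using \<open>N > 0\<close> by (simp add: field_simps)
    also have "\<dots> < real N * 1"
      using \<open>N > 0\<close> L[OF \<open>L \<le> N\<close>] by (intro mult_strict_left_mono) auto
    finally show False
      using N \<open>N > 0\<close> by simp
  qed
  then show ?thesis
    by blast
qed

theorem theorem6p1:
  fixes U :: dcqtm and num :: "nat \<Rightarrow> str"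
  assumes "universal_dcq_TM U" and "effective_encoding num"
  shows "\<not> (\<exists>g::real. \<forall>(n::nat) nA nB (\<rho>::complex mat).
     nA \<ge> 1 \<longrightarrow> nB \<ge> 1 \<longrightarrow> n = nA + nB \<longrightarrow> qstate n \<rho> \<longrightarrow> dcq_computable U num \<rho> \<longrightarrow>
       ereal_of_enat (K U num \<rho>) \<le>
         ereal_of_enat (K U num (reduced_first nA nB \<rho>))
         + ereal_of_enat (K_cond U num (reduced_last nA nB \<rho>) (reduced_first nA nB \<rho>))
         + ereal (g * log 2 (real n *
             (if K U num \<rho> = 0 then 1 else real (the_enat (K U num \<rho>))))))"
proof
  assume "\<exists>g::real. \<forall>(n::nat) nA nB (\<rho>::complex mat).
     nA \<ge> 1 \<longrightarrow> nB \<ge> 1 \<longrightarrow> n = nA + nB \<longrightarrow> qstate n \<rho> \<longrightarrow> dcq_computable U num \<rho> \<longrightarrow>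
       ereal_of_enat (K U num \<rho>) \<le>
         ereal_of_enat (K U num (reduced_first nA nB \<rho>))
         + ereal_of_enat (K_cond U num (reduced_last nA nB \<rho>) (reduced_first nA nB \<rho>))
         + ereal (g * log 2 (real n *
             (if K U num \<rho> = 0 then 1 else real (the_enat (K U num \<rho>)))))"
  then obtain g where g: "\<And>n nA nB (\<rho>::complex mat).
     nA \<ge> 1 \<Longrightarrow> nB \<ge> 1 \<Longrightarrow> n = nA + nB \<Longrightarrow> qstate n \<rho> \<Longrightarrow> dcq_computable U num \<rho> \<Longrightarrow>
       ereal_of_enat (K U num \<rho>) \<le>
         ereal_of_enat (K U num (reduced_first nA nB \<rho>))
         + ereal_of_enat (K_cond U num (reduced_last nA nB \<rho>) (reduced_first nA nB \<rho>))
         + ereal (g * log 2 (real n *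
             (if K U num \<rho> = 0 then 1 else real (the_enat (K U num \<rho>)))))"
    by blast
  have TM: "dcq_TM (straight_line (bell_program w t))" for w t
    by (rule dcq_TM_straight_line) (simp add: bell_program_def)
  have "mixed_qubit \<in> carrier_mat 2 2"
    by (simp add: mixed_qubit_def)
  \<comment> \<open>Both complexities on the right-hand side are finite constants, independent of
    the number of rotations.\<close>
  from K_finite_of_constant[OF assms(1) TM this dcq_run_bell_program(2)]
  obtain C C' where C: "K U num mixed_qubit = enat C" "K_cond U num mixed_qubit mixed_qubit = enat C'"
    by (metis enat_ord_simps(4) not_infinity_eq)
  obtain L where L: "\<And>N::nat. real N \<le> real (C + C') + g * log 2 (2 * (if N = 0 then 1 else real N)) \<Longrightarrow> N \<le> L"
    using le_log_bounded[of "real (C + C')" g] by blast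
  have carrier: "rotated_bell_state t \<in> carrier_mat 4 4" for t
    by (simp add: rotated_bell_state_def)
  have "K U num (rotated_bell_state t) \<le> enat L" for t
  proof -
    have finite: "K U num (rotated_bell_state t) < \<infinity>"
      by (rule K_finite_of_constant(1)[OF assms(1) TM carrier dcq_run_bell_program(1)])
    then obtain N where N: "K U num (rotated_bell_state t) = enat N"
      by auto
    \<comment> \<open>The assumed bound for one qubit on each side; the factor 2 inside the
      logarithm is \<open>n\<close>.\<close>
    have "ereal (real N) \<le> ereal (real C) + ereal (real C')
        + ereal (g * log 2 (2 * (if N = 0 then 1 else real N)))"
      using g[of 1 1 2 "rotated_bell_state t"] finite qstate_rotated_bell_state[of t]
      unfolding reduced_rotated_bell C N
      by (cases "N = 0") (simp_all add: dcq_computable_def N zero_enat_def)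
    then have "N \<le> L"
      by (intro L) simp
    then show ?thesis
      by (simp add: N)
  qed
  \<comment> \<open>An infinite family of states would lie in the finite set of states of complexity
    at most \<open>L\<close>.\<close>
  then have "range (\<lambda>t. rotated_bell_state (t + 2)) \<subseteq> {\<rho> \<in> carrier_mat 4 4. K U num \<rho> \<le> enat L}"
    using carrier by auto
  then have "finite (range (\<lambda>t. rotated_bell_state (t + 2)))"
    by (rule finite_subset) (rule finite_K_le)
  then show False
    using finite_imageD[OF _ inj_rotated_bell_state] by simp
qed

end
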